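(* Let $(X,\delta)$ be a metric space and let $K\subseteq X$ be a compactly-bounded set. If $f,g:K\to\mathbb{R}$ have means and $\alpha,\beta$ are constants, then $\widehat{(\alpha f+\beta g)}=\alpha\hat f+\beta\hat g$.
   Context: A subset $K$ of a metric space $(X,\delta)$ is compactly-bounded if it is a nonempty subset of some compact subset of $X$. For $\varepsilon>0$, a set $S\subseteq X$ is an $\varepsilon$-dispersion if $\delta(x,y)\ge\varepsilon$ for all distinct $x,y\in S$. An $\varepsilon$-lattice of a set $T\subseteq X$ is an $\varepsilon$-dispersion $S\subseteq T$ such that no set $U$ with $S\subsetneq U\subseteq T$ is an $\varepsilon$-dispersion. $L_\varepsilon(K)$ is the collection of all $\varepsilon$-lattices of $K$; since $K$ is compactly-bounded, each of its members is a finite set. For $f:K\to\mathbb{R}$ and a nonempty finite $S\subseteq K$, $M_f(S)=\frac{1}{|S|}\sum_{s\in S}f(s)$. Put $l_\varepsilon(f)=\inf_{S\in L_\varepsilon(K)}M_f(S)$ and $u_\varepsilon(f)=\sup_{S\in L_\varepsilon(K)}M_f(S)$. The function $f$ has a mean if and only if $\lim_{\varepsilon\to0}l_\varepsilon(f)=\lim_{\varepsilon\to0}u_\varepsilon(f)$; in that case the common limit, denoted $\hat f$ (or $\widehat{(f)}$), is the mean of $f$. Functions are combined pointwise: $(\alpha f+\beta g)(x)=\alpha f(x)+\beta g(x)$. *)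

theory Defs
  imports "HOL-Analysis.Analysis"
begin

definition compactly_bounded :: "'a::metric_space set \<Rightarrow> bool" where
  "compactly_bounded K \<longleftrightarrow> K \<noteq> {} \<and> (\<exists>C. compact C \<and> K \<subseteq> C)"

definition dispersion :: "real \<Rightarrow> 'a::metric_space set \<Rightarrow> bool" where
  "dispersion \<epsilon> S \<longleftrightarrow> (\<forall>x\<in>S. \<forall>y\<in>S. x \<noteq> y \<longrightarrow> \<epsilon> \<le> dist x y)"

definition lattices :: "real \<Rightarrow> 'a::metric_space set \<Rightarrow> 'a set set" where
  "lattices \<epsilon> T =
     {S. S \<subseteq> T \<and> dispersion \<epsilon> S \<and> \<not> (\<exists>U. S \<subset> U \<and> U \<subseteq> T \<and> dispersion \<epsilon> U)}"

(* Functions on K are represented by total functions whose values outside K are never used. *)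
definition avg :: "('a \<Rightarrow> real) \<Rightarrow> 'a set \<Rightarrow> real" where
  "avg f S = (\<Sum>s\<in>S. f s) / real (card S)"

(* f need not be bounded on K, so the infimum and supremum are taken in the extended reals. *)
definition lower_avg :: "'a::metric_space set \<Rightarrow> ('a \<Rightarrow> real) \<Rightarrow> real \<Rightarrow> ereal" where
  "lower_avg K f \<epsilon> = (INF S\<in>lattices \<epsilon> K. ereal (avg f S))"

definition upper_avg :: "'a::metric_space set \<Rightarrow> ('a \<Rightarrow> real) \<Rightarrow> real \<Rightarrow> ereal" where
  "upper_avg K f \<epsilon> = (SUP S\<in>lattices \<epsilon> K. ereal (avg f S))"

(* The common limit has to be a real number: a common limit of plus or minus infinity
   is not a mean. *)
definition is_mean :: "'a::metric_space set \<Rightarrow> ('a \<Rightarrow> real) \<Rightarrow> real \<Rightarrow> bool" where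
  "is_mean K f m \<longleftrightarrow>
     (lower_avg K f \<longlongrightarrow> ereal m) (at_right 0) \<and> (upper_avg K f \<longlongrightarrow> ereal m) (at_right 0)"

definition has_mean :: "'a::metric_space set \<Rightarrow> ('a \<Rightarrow> real) \<Rightarrow> bool" where
  "has_mean K f \<longleftrightarrow> (\<exists>m. is_mean K f m)"

definition mean :: "'a::metric_space set \<Rightarrow> ('a \<Rightarrow> real) \<Rightarrow> real" where
  "mean K f = (THE m. is_mean K f m)"

end

theory Submission
  imports Defs
begin

text \<open>
  A real number m is a mean of f exactly when, for small \<open>\<epsilon>\<close>, there are
  \<open>\<epsilon>\<close>-lattices and all their averages are uniformly close to m. Averages over a
  single lattice are linear in the function, so closeness passes to linear combinations.
  Lattices exist for small \<open>\<epsilon>\<close> because otherwise the lower average would be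
  \<open>\<infinity>\<close>, which cannot happen near a real limit.
\<close>

lemma avg_linear: "avg (\<lambda>x. \<alpha> * f x + \<beta> * g x) S = \<alpha> * avg f S + \<beta> * avg g S"
  by (simp add: avg_def sum.distrib sum_distrib_left[symmetric] add_divide_distrib)

text \<open>Trades limits of infima and suprema in \<open>ereal\<close> for real estimates on
  individual lattices, where linearity of \<open>avg\<close> applies. Each average lies between
  \<open>lower_avg\<close> and \<open>upper_avg\<close>; conversely, a weak bound on all averages
  passes to their infimum and supremum.\<close>

lemma is_mean_iff:
  "is_mean K f m \<longleftrightarrow>
     (\<forall>e>0. \<forall>\<^sub>F \<epsilon> in at_right 0. lattices \<epsilon> K \<noteq> {} \<and>
        (\<forall>S\<in>lattices \<epsilon> K. \<bar>avg f S - m\<bar> \<le> e))"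
  (is "_ \<longleftrightarrow> (\<forall>e>0. ?close e)")
proof (intro iffI allI impI)
  fix e :: real
  assume m: "is_mean K f m" and e: "e > 0"
  have lim: "(lower_avg K f \<longlongrightarrow> ereal m) (at_right 0)"
    "(upper_avg K f \<longlongrightarrow> ereal m) (at_right 0)"
    using m by (auto simp: is_mean_def)
  have "ereal (m - e) < ereal m" "ereal m < ereal (m + e)"
    using e by auto
  then have "\<forall>\<^sub>F \<epsilon> in at_right 0. ereal (m - e) < lower_avg K f \<epsilon>"
    "\<forall>\<^sub>F \<epsilon> in at_right 0. lower_avg K f \<epsilon> < ereal (m + e)"
    "\<forall>\<^sub>F \<epsilon> in at_right 0. upper_avg K f \<epsilon> < ereal (m + e)"
    using order_tendstoD lim by blast+
  then show "?close e"
  proof eventually_elim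
    case (elim \<epsilon>)
    \<comment> \<open>The upper bound on \<open>lower_avg\<close> enters only here: an infimum over
      the empty family is the top element.\<close>
    have "lattices \<epsilon> K \<noteq> {}"
      using elim(2) by (auto simp: lower_avg_def top_ereal_def)
    moreover have "\<bar>avg f S - m\<bar> \<le> e" if "S \<in> lattices \<epsilon> K" for S
    proof -
      have "lower_avg K f \<epsilon> \<le> ereal (avg f S)" "ereal (avg f S) \<le> upper_avg K f \<epsilon>"
        using that unfolding lower_avg_def upper_avg_def by (auto intro: INF_lower SUP_upper)
      with elim(1,3) have "ereal (m - e) < ereal (avg f S)" "ereal (avg f S) < ereal (m + e)"
        using less_le_trans le_less_trans by blast+
      then show ?thesis
        by (simp add: abs_le_iff)
    qed
    ultimately show ?case by blast
  qed
next
  assume close: "\<forall>e>0. ?close e"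
  \<comment> \<open>Nonemptiness yields the middle inequality, so one outer bound controls both
    averages.\<close>
  have bounds: "\<forall>\<^sub>F \<epsilon> in at_right 0. ereal (m - e) \<le> lower_avg K f \<epsilon> \<and>
      lower_avg K f \<epsilon> \<le> upper_avg K f \<epsilon> \<and> upper_avg K f \<epsilon> \<le> ereal (m + e)"
    if "e > 0" for e
    using close[rule_format, OF that]
  proof eventually_elim
    case (elim \<epsilon>)
    then have "m - e \<le> avg f S" "avg f S \<le> m + e" if "S \<in> lattices \<epsilon> K" for S
      using that by (fastforce simp: abs_le_iff)+
    then show ?case
      using elim unfolding lower_avg_def upper_avg_def
      by (auto intro!: INF_greatest SUP_least INF_le_SUP)
  qed
  have below: "\<forall>\<^sub>F \<epsilon> in at_right 0. a < lower_avg K f \<epsilon> \<and> a < upper_avg K f \<epsilon>"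
    if a: "a < ereal m" for a
  proof -
    \<comment> \<open>A real \<open>r\<close> strictly in between, available even for infinite
      \<open>a\<close>, makes the weak bounds strict: with \<open>e = m - r\<close>, the lower bound
      \<open>m - e\<close> is exactly \<open>r\<close>.\<close>
    obtain r where r: "a < ereal r" "ereal r < ereal m"
      using ereal_dense2[OF a] by auto
    show ?thesis
      using bounds[of "m - r"] r by (auto elim!: eventually_mono)
  qed
  have above: "\<forall>\<^sub>F \<epsilon> in at_right 0. lower_avg K f \<epsilon> < a \<and> upper_avg K f \<epsilon> < a"
    if a: "ereal m < a" for a
  proof -
    obtain r where r: "ereal m < ereal r" "ereal r < a"
      using ereal_dense2[OF a] by auto
    show ?thesis
      using bounds[of "r - m"] r by (auto elim!: eventually_mono)
  qed
  show "is_mean K f m"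
    unfolding is_mean_def
    using below above by (auto simp: order_tendsto_iff eventually_conj_iff)
qed

text \<open>Limits in the Hausdorff space \<open>ereal\<close> along the nontrivial filter
  \<open>at_right 0\<close> are unique, so the \<open>THE\<close> in \<open>mean\<close> is well
  defined.\<close>

lemma is_mean_unique:
  assumes "is_mean K f m" "is_mean K f m'"
  shows "m = m'"
  using tendsto_unique[of "at_right (0::real)" "lower_avg K f" "ereal m" "ereal m'"] assms
  by (simp add: is_mean_def)

lemma mean_eqI: "is_mean K f m \<Longrightarrow> mean K f = m"
  unfolding mean_def by (blast intro: is_mean_unique)

text \<open>Averages of both functions run over the same lattices, so their errors combine lattice
  by lattice.\<close>

lemma is_mean_linear:
  assumes "is_mean K f a" "is_mean K g b"
  shows "is_mean K (\<lambda>x. \<alpha> * f x + \<beta> * g x) (\<alpha> * a + \<beta> * b)"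
  unfolding is_mean_iff
proof (intro allI impI)
  fix e :: real
  assume e: "e > 0"
  \<comment> \<open>The total error will be at most
    \<open>(\<bar>\<alpha>\<bar> + \<bar>\<beta>\<bar>) * d\<close>; the added 1 keeps the
    denominator positive when both coefficients vanish.\<close>
  define d where "d = e / (\<bar>\<alpha>\<bar> + \<bar>\<beta>\<bar> + 1)"
  have d: "d > 0"
    using e by (simp add: d_def add_nonneg_pos)
  have "(\<bar>\<alpha>\<bar> + \<bar>\<beta>\<bar> + 1) * d = e"
    by (simp add: d_def add_nonneg_pos less_imp_neq[symmetric])
  with d have d_le: "\<bar>\<alpha>\<bar> * d + \<bar>\<beta>\<bar> * d \<le> e"
    by (simp add: algebra_simps)
  from d have "\<forall>\<^sub>F \<epsilon> in at_right 0. lattices \<epsilon> K \<noteq> {} \<and> (\<forall>S\<in>lattices \<epsilon> K. \<bar>avg f S - a\<bar> \<le> d)"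
    "\<forall>\<^sub>F \<epsilon> in at_right 0. lattices \<epsilon> K \<noteq> {} \<and> (\<forall>S\<in>lattices \<epsilon> K. \<bar>avg g S - b\<bar> \<le> d)"
    using assms unfolding is_mean_iff by blast+
  then show "\<forall>\<^sub>F \<epsilon> in at_right 0. lattices \<epsilon> K \<noteq> {} \<and>
      (\<forall>S\<in>lattices \<epsilon> K. \<bar>avg (\<lambda>x. \<alpha> * f x + \<beta> * g x) S - (\<alpha> * a + \<beta> * b)\<bar> \<le> e)"
  proof eventually_elim
    case (elim \<epsilon>)
    have "\<bar>avg (\<lambda>x. \<alpha> * f x + \<beta> * g x) S - (\<alpha> * a + \<beta> * b)\<bar> \<le> e"
      if S: "S \<in> lattices \<epsilon> K" for S
    proof -
      have "avg (\<lambda>x. \<alpha> * f x + \<beta> * g x) S - (\<alpha> * a + \<beta> * b)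
          = \<alpha> * (avg f S - a) + \<beta> * (avg g S - b)"
        by (simp add: avg_linear algebra_simps)
      also have "\<bar>\<dots>\<bar> \<le> \<bar>\<alpha>\<bar> * \<bar>avg f S - a\<bar> + \<bar>\<beta>\<bar> * \<bar>avg g S - b\<bar>"
        by (metis abs_mult abs_triangle_ineq)
      also have "\<dots> \<le> \<bar>\<alpha>\<bar> * d + \<bar>\<beta>\<bar> * d"
        using elim S by (intro add_mono mult_left_mono) auto
      finally show ?thesis
        using d_le by simp
    qed
    with elim show ?case by blast
  qed
qed

theorem proposition2p5:
  fixes K :: "'a::metric_space set"
    and f g :: "'a \<Rightarrow> real"
    and \<alpha> \<beta> :: real
  assumes "compactly_bounded K"
    and "has_mean K f"
    and "has_mean K g"
  shows "has_mean K (\<lambda>x. \<alpha> * f x + \<beta> * g x) \<and>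
         mean K (\<lambda>x. \<alpha> * f x + \<beta> * g x) = \<alpha> * mean K f + \<beta> * mean K g"
proof -
  obtain a b where "is_mean K f a" "is_mean K g b"
    using assms by (auto simp: has_mean_def)
  then show ?thesis
    using is_mean_linear[of K f a g b \<alpha> \<beta>] by (auto simp: has_mean_def mean_eqI)
qed

end
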